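(* Fix $\alpha,\beta>0$, let $\kappa:=\beta/\alpha$ and $N:=\lfloor(\kappa-5)/16\rfloor$, and suppose that $\kappa\ge 85$. For every integer $1\le k\le 6N$ and every deterministic method using at most $\lfloor N/(4k)\rfloor$ calls to a $k$-fold sparse projection oracle, there exists an instance in dimension $n=6N$ with an $\alpha$-strongly convex and $\beta$-smooth quadratic objective $f:\mathbb R^{6N}\to\mathbb R$, a compact convex feasible set $\mathcal K\subset\mathbb R^{6N}$ with diameter $D\le 2$, and a unique minimizer $w^*$ of $f$ over $\mathcal K$, which is a vertex of $\mathcal K$, such that the point $\widehat w$ returned by the method is either infeasible ($\widehat w\notin\mathcal K$) or satisfies $$ f(\widehat w)-f(w^* )\ \ge\ \frac{\alpha}{4}. $$ Consequently, for $\epsilon=\alpha/8$, every deterministic method that guarantees an $\epsilon$-optimal feasible point on all such instances requires $\Omega\left(\beta/(\alpha k)\right)$ calls to the $k$-fold sparse projection oracle in the worst case (with a universal constant in the $\Omega$).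
   Context: Problem: minimize $F=f+I_{\mathcal K}$, i.e. minimize a convex $f$ over a convex compact set $\mathcal K=\mathrm{conv}(\mathcal V)\subset\mathbb R^n$, where $\mathcal V$ is the set of vertices (extreme points) of $\mathcal K$; norms are Euclidean. $\beta$-smooth means differentiable with $\beta$-Lipschitz gradient. All instances are such that the unique minimizer is a single vertex. $k$-fold sparse projection oracle (for the case in which the optimal solution is a single vertex): for $k\le n$, let $\mathcal C_k=\{\sum_{i=1}^p\lambda_i v_i:\ p\le k,\ v_i\in\mathcal V,\ \lambda_i\ge 0,\ \sum_i\lambda_i=1\}$. The oracle, given any $y\in\mathbb R^n$, outputs a point of $\arg\min_{z\in\mathcal C_k}\|z-y\|$; ties are broken by a deterministic rule that is part of the instance. Access model: the method is not given an explicit description of $\mathcal K$; its only access to $\mathcal K$ is through calls to the $k$-fold sparse projection oracle. It may otherwise perform arbitrary computations and make arbitrarily many calls to a first-order oracle for $f$ (returning $f(w)$ and $\nabla f(w)$ at a query $w$). A deterministic method is a deterministic rule which, as a function of all oracle answers received so far, chooses the next oracle and query, or stops and returns a point $\widehat w\in\mathbb R^n$. An $\epsilon$-optimal feasible point is $\widehat w\in\mathcal K$ with $f(\widehat w)-\min_{\mathcal K}f\le\epsilon$. The instance in the statement may depend on the method. *)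

theory Defs
  imports "HOL-Analysis.Analysis"
begin

definition gradient :: "('a::real_inner \<Rightarrow> real) \<Rightarrow> 'a \<Rightarrow> 'a" where
  "gradient f x = (THE g. GDERIV f x :> g)"

definition quadratic :: "(real ^ 'n \<Rightarrow> real) \<Rightarrow> bool" where
  "quadratic f \<longleftrightarrow>
     (\<exists>(A :: real ^ 'n ^ 'n) b c. \<forall>x. f x = x \<bullet> (A *v x) + b \<bullet> x + c)"

definition strongly_convex :: "real \<Rightarrow> ('a::real_inner \<Rightarrow> real) \<Rightarrow> bool" where
  "strongly_convex \<alpha> f \<longleftrightarrow>
     (\<forall>x y. \<forall>t\<in>{0..1}.
        f (t *\<^sub>R x + (1 - t) *\<^sub>R y)
          \<le> t * f x + (1 - t) * f y - \<alpha> / 2 * t * (1 - t) * (norm (x - y))\<^sup>2)"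

definition smooth :: "real \<Rightarrow> ('a::real_inner \<Rightarrow> real) \<Rightarrow> bool" where
  "smooth \<beta> f \<longleftrightarrow> (\<forall>x. f differentiable (at x)) \<and> \<beta>-lipschitz_on UNIV (gradient f)"

definition vertices :: "'a::real_vector set \<Rightarrow> 'a set" where
  "vertices K = {v. v extreme_point_of K}"

definition sparse_hull :: "nat \<Rightarrow> 'a::real_vector set \<Rightarrow> 'a set" where
  "sparse_hull k V =
     {(\<Sum>i<p. l i *\<^sub>R v i) | p (l :: nat \<Rightarrow> real) v.
        p \<le> k \<and> (\<forall>i<p. v i \<in> V \<and> 0 \<le> l i) \<and> (\<Sum>i<p. l i) = 1}"

text \<open>The field \<open>proj_oracle\<close> is the \<open>k\<close>-fold sparse projection oracle of the instance. Being a
  function of the query point, it also carries the tie-breaking rule.\<close>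

record 'n problem =
  objective :: "real ^ 'n \<Rightarrow> real"
  feasible :: "(real ^ 'n) set"
  proj_oracle :: "real ^ 'n \<Rightarrow> real ^ 'n"

definition minimizer :: "('n::finite) problem \<Rightarrow> real ^ 'n \<Rightarrow> bool" where
  "minimizer I w \<longleftrightarrow> is_arg_min (objective I) (\<lambda>x. x \<in> feasible I) w"

definition sparse_projection_oracle ::
  "nat \<Rightarrow> 'a::real_normed_vector set \<Rightarrow> ('a \<Rightarrow> 'a) \<Rightarrow> bool" where
  "sparse_projection_oracle k K P \<longleftrightarrow>
     (\<forall>y. is_arg_min (\<lambda>z. norm (z - y)) (\<lambda>z. z \<in> sparse_hull k (vertices K)) (P y))"

definition instances :: "real \<Rightarrow> real \<Rightarrow> nat \<Rightarrow> ('n::finite) problem set" where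
  "instances \<alpha> \<beta> k =
     {I. quadratic (objective I) \<and> strongly_convex \<alpha> (objective I) \<and> smooth \<beta> (objective I) \<and>
         compact (feasible I) \<and> convex (feasible I) \<and> diameter (feasible I) \<le> 2 \<and>
         (\<exists>!w. minimizer I w) \<and> (\<forall>w. minimizer I w \<longrightarrow> w \<in> vertices (feasible I)) \<and>
         sparse_projection_oracle k (feasible I) (proj_oracle I)}"

definition eps_optimal :: "real \<Rightarrow> ('n::finite) problem \<Rightarrow> real ^ 'n \<Rightarrow> bool" where
  "eps_optimal \<epsilon> I w \<longleftrightarrow>
     w \<in> feasible I \<and> objective I w - (INF x\<in>feasible I. objective I x) \<le> \<epsilon>"

datatype 'v action = Project 'v | Evaluate 'v | Return 'v

datatype 'v answer = Projection 'v | First_Order real 'v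

text \<open>A method sees only the answers received so far, oldest first; its own earlier queries are
  determined by them.\<close>

type_synonym 'n deterministic_method = "(real ^ 'n) answer list \<Rightarrow> (real ^ 'n) action"

text \<open>\<open>returns_from M I h w m\<close>: continuing from the answers \<open>h\<close>, the method stops after finitely
  many steps and returns \<open>w\<close>, making exactly \<open>m\<close> further calls to the sparse projection oracle.
  First-order calls are not counted.\<close>

inductive returns_from ::
  "('n::finite) deterministic_method \<Rightarrow> 'n problem \<Rightarrow> (real ^ 'n) answer list
     \<Rightarrow> real ^ 'n \<Rightarrow> nat \<Rightarrow> bool"
  for M :: "('n::finite) deterministic_method" and I :: "'n problem" where
  stop: "M h = Return w \<Longrightarrow> returns_from M I h w 0"
| project: "M h = Project y \<Longrightarrow> returns_from M I (h @ [Projection (proj_oracle I y)]) w m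
     \<Longrightarrow> returns_from M I h w (Suc m)"
| evaluate: "M h = Evaluate x
     \<Longrightarrow> returns_from M I (h @ [First_Order (objective I x) (gradient (objective I) x)]) w m
     \<Longrightarrow> returns_from M I h w m"

abbreviation returns ::
  "('n::finite) deterministic_method \<Rightarrow> 'n problem \<Rightarrow> real ^ 'n \<Rightarrow> nat \<Rightarrow> bool" where
  "returns M I w m \<equiv> returns_from M I [] w m"

end

theory Submission
  imports Defs
begin

text \<open>Answer every projection query \<open>y\<close> as if the vertices were the unit vectors \<open>e\<^sub>i\<close>,
  \<open>i \<in> E\<close>, with \<open>|E| = 4N\<close>; the objective has curvature \<open>\<beta>\<close> on their span and \<open>\<alpha>\<close> on its
  orthogonal complement. The answers involve only a set \<open>S\<close> of at most \<open>N\<close> of the vertices. Let \<open>c\<close>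
  be a point of the simplex and \<open>w = c + h\<close> a unit vector with \<open>h\<close> orthogonal to the simplex, to all
  queries and to the returned point. Replacing the unrevealed vertices by \<open>w\<close> is undetectable: in a
  combination \<open>l w + x\<close> some \<open>e\<^sub>i\<close> with \<open>e\<^sub>i \<bullet> (x - y) \<le> c \<bullet> (x - y) = w \<bullet> (x - y)\<close> can be
  substituted for \<open>w\<close> without increasing the distance to \<open>y\<close>. For \<open>c\<close> halfway between the
  barycentres of \<open>S\<close> and \<open>E\<close>, the gradient at \<open>w\<close> is nonnegative towards each revealed vertex, because
  \<open>\<beta> (1/|S| - 1/|E|) \<ge> 4 \<alpha>\<close>. Hence \<open>w\<close> is the minimizer, and strong convexity gives the gap,
  since the returned point has no \<open>h\<close>-component.\<close>

subsection \<open>Sparse hulls of unit vectors\<close>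

text \<open>The unit ball is strictly convex: inside a segment the norm drops below that of one
  endpoint, so no unit vector lies strictly between two points of the ball. This makes the hidden
  point a vertex whatever the other unit vectors are.\<close>

lemma vertices_convex_hull_unit_vectors:
  fixes V :: "'a::euclidean_space set"
  assumes unit: "\<And>v. v \<in> V \<Longrightarrow> norm v = 1"
  shows "vertices (convex hull V) = V"
proof
  show "vertices (convex hull V) \<subseteq> V"
    using extreme_points_of_convex_hull by (auto simp: vertices_def)
  have ball: "convex hull V \<subseteq> cball 0 1"
    by (rule hull_minimal) (auto simp: unit)
  show "V \<subseteq> vertices (convex hull V)"
  proof
    fix v assume v: "v \<in> V"
    have False if ab: "a \<in> convex hull V" "b \<in> convex hull V" "v \<in> open_segment a b" for a b
    proof -
      have "norm a \<le> 1" "norm b \<le> 1" using ball ab(1,2) by auto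
      moreover have "norm v < norm a \<or> norm v < norm b"
        using dist_decreases_open_segment[OF ab(3), of 0] by (auto simp: dist_norm)
      ultimately show False using unit[OF v] by linarith
    qed
    then show "v \<in> vertices (convex hull V)"
      using v by (auto simp: vertices_def extreme_point_of_def hull_inc)
  qed
qed

text \<open>Repetitions among the points \<open>v i\<close> only shrink the set they form, so
  indexed combinations may be traded for hulls of small sets. For finite \<open>V\<close> this is a
  finite union of compact sets, and exchanging a vertex becomes an \<open>insert\<close>.\<close>

lemma sparse_hull_eq_Union:
  "sparse_hull k V = (\<Union>T\<in>{T. T \<subseteq> V \<and> finite T \<and> card T \<le> k}. convex hull T)"
proof (intro equalityI subsetI)
  fix z assume "z \<in> sparse_hull k V"
  then obtain p and l :: "nat \<Rightarrow> real" and v where z: "z = (\<Sum>i<p. l i *\<^sub>R v i)" and "p \<le> k"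
    and v: "\<And>i. i < p \<Longrightarrow> v i \<in> V \<and> 0 \<le> l i" and l: "(\<Sum>i<p. l i) = 1"
    unfolding sparse_hull_def by blast
  have "(\<Sum>i<p. l i *\<^sub>R v i) \<in> convex hull (v ` {..<p})"
    by (rule convex_sum) (use v l in \<open>auto simp: hull_inc\<close>)
  moreover have "card (v ` {..<p}) \<le> k"
    using card_image_le[of "{..<p}" v] \<open>p \<le> k\<close> by simp
  ultimately show "z \<in> (\<Union>T\<in>{T. T \<subseteq> V \<and> finite T \<and> card T \<le> k}. convex hull T)"
    using v z by (intro UN_I[of "v ` {..<p}"]) auto
next
  fix z assume "z \<in> (\<Union>T\<in>{T. T \<subseteq> V \<and> finite T \<and> card T \<le> k}. convex hull T)"
  then obtain T where T: "T \<subseteq> V" "finite T" "card T \<le> k" "z \<in> convex hull T" by blast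
  then obtain u where u: "\<And>x. x \<in> T \<Longrightarrow> 0 \<le> u x" "sum u T = 1" "(\<Sum>x\<in>T. u x *\<^sub>R x) = z"
    by (auto simp: convex_hull_finite)
  obtain g where g: "bij_betw g {..<card T} T"
    using T(2) ex_bij_betw_nat_finite by (metis lessThan_atLeast0)
  have "z = (\<Sum>i<card T. u (g i) *\<^sub>R g i)" "(\<Sum>i<card T. u (g i)) = 1"
    using u sum.reindex_bij_betw[OF g, of u] sum.reindex_bij_betw[OF g, of "\<lambda>x. u x *\<^sub>R x"] by auto
  moreover have "g i \<in> V \<and> 0 \<le> u (g i)" if "i < card T" for i
    using g u(1) T(1) that by (force simp: bij_betw_def)
  ultimately show "z \<in> sparse_hull k V"
    unfolding sparse_hull_def using T(3)
    by (intro CollectI exI[of _ "card T"] exI[of _ "\<lambda>i. u (g i)"] exI[of _ g]) auto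
qed

lemma sparse_projection_exists:
  fixes V :: "'a::euclidean_space set"
  assumes "finite V" "V \<noteq> {}" "1 \<le> k"
  shows "\<exists>z. is_arg_min (\<lambda>z. norm (z - y)) (\<lambda>z. z \<in> sparse_hull k V) z"
proof -
  have "compact (sparse_hull k V)"
    unfolding sparse_hull_eq_Union
    by (rule compact_UN) (use assms(1) in \<open>auto intro: finite_imp_compact_convex_hull\<close>)
  moreover obtain v where "v \<in> V" using assms(2) by blast
  then have "v \<in> sparse_hull k V"
    using assms(3) by (auto simp: sparse_hull_eq_Union intro!: exI[of _ "{v}"])
  moreover have "continuous_on (sparse_hull k V) (\<lambda>z. norm (z - y))"
    by (intro continuous_intros)
  ultimately obtain z where "z \<in> sparse_hull k V" "\<forall>x\<in>sparse_hull k V. norm (z - y) \<le> norm (x - y)"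
    using continuous_attains_inf[of "sparse_hull k V" "\<lambda>z. norm (z - y)"] by blast
  then show ?thesis by (auto simp: is_arg_min_linorder)
qed

text \<open>The weight \<open>l\<close> and the remainder \<open>x\<close> do not depend on
  \<open>d\<close>, so any point can take over the weight of \<open>w\<close>. Since
  \<open>x\<close> already carries its own weight, it lies only in the span of
  \<open>T\<close>.\<close>

lemma convex_hull_insert_replace:
  fixes w :: "'a::real_vector"
  assumes "z \<in> convex hull (insert w T)"
  obtains l x where "0 \<le> l" "z = l *\<^sub>R w + x" "x \<in> span T"
    "\<And>d. l *\<^sub>R d + x \<in> convex hull (insert d T)"
proof (cases "T = {}")
  case True
  then show ?thesis using assms that[of 1 0] by simp
next
  case False
  then obtain u v b where uvb: "0 \<le> u" "0 \<le> v" "u + v = 1" "b \<in> convex hull T"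
      "z = u *\<^sub>R w + v *\<^sub>R b"
    using assms by (auto simp: convex_hull_insert)
  show ?thesis
  proof (rule that[of u "v *\<^sub>R b"])
    show "v *\<^sub>R b \<in> span T"
      using uvb(4) convex_hull_subset_span span_scale by blast
    show "u *\<^sub>R d + v *\<^sub>R b \<in> convex hull (insert d T)" for d
      using uvb(1-4) False by (auto simp: convex_hull_insert)
  qed (use uvb in auto)
qed

text \<open>For a unit vector \<open>a\<close> and a fixed weight \<open>l\<close>, the squared
  distance from \<open>l *\<^sub>R a + x\<close> to \<open>y\<close> depends on \<open>a\<close>
  only through its inner product with \<open>x - y\<close>. For \<open>w\<close> this product equals
  that of \<open>c\<close>, an average of vertices, and some vertex does no worse than the
  average.\<close>

lemma sparse_hull_replace_unit_vector:
  fixes w c y :: "'a::euclidean_space"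
  assumes unit: "\<And>v. v \<in> V \<Longrightarrow> norm v = 1" and w: "norm w = 1"
    and c: "c \<in> convex hull V"
    and orth: "\<And>v. v \<in> V \<Longrightarrow> orthogonal (w - c) v" and y: "orthogonal (w - c) y"
    and z: "z \<in> sparse_hull k (insert w V)"
  obtains z' where "z' \<in> sparse_hull k V" "norm (z' - y) \<le> norm (z - y)"
proof -
  obtain T where T: "T \<subseteq> insert w V" "finite T" "card T \<le> k" "z \<in> convex hull T"
    using z by (auto simp: sparse_hull_eq_Union)
  show ?thesis
  proof (cases "w \<in> T")
    case False
    then show ?thesis using T that[of z] by (auto simp: sparse_hull_eq_Union)
  next
    case True
    define T' where "T' = T - {w}"
    have T': "T = insert w T'" "w \<notin> T'" "T' \<subseteq> V" "finite T'"
      using True T by (auto simp: T'_def)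
    obtain l x where lx: "0 \<le> l" "z = l *\<^sub>R w + x" "x \<in> span T'"
        "\<And>d. l *\<^sub>R d + x \<in> convex hull (insert d T')"
      using T(4) T'(1) convex_hull_insert_replace by metis
    have "orthogonal (w - c) x"
      using lx(3) T'(3) orth by (intro orthogonal_to_span[of x T']) auto
    then have wc: "w \<bullet> (x - y) = c \<bullet> (x - y)"
      using y by (simp add: orthogonal_def inner_diff_left inner_diff_right)
    have "\<exists>d\<in>V. d \<bullet> (x - y) \<le> c \<bullet> (x - y)"
    proof (rule ccontr)
      assume "\<not> ?thesis"
      then have "V \<subseteq> {d. (x - y) \<bullet> d > (x - y) \<bullet> c}" by (auto simp: inner_commute)
      then have "convex hull V \<subseteq> {d. (x - y) \<bullet> d > (x - y) \<bullet> c}"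
        by (rule hull_minimal) (rule convex_halfspace_gt)
      then show False using c by auto
    qed
    then obtain d where d: "d \<in> V" "d \<bullet> (x - y) \<le> c \<bullet> (x - y)" by blast
    have expand: "(norm (l *\<^sub>R a + x - y))\<^sup>2 = l\<^sup>2 + 2 * l * (a \<bullet> (x - y)) + (norm (x - y))\<^sup>2"
      if "norm a = 1" for a
    proof -
      have "(norm (l *\<^sub>R a + u))\<^sup>2 = l\<^sup>2 * (a \<bullet> a) + 2 * l * (a \<bullet> u) + (norm u)\<^sup>2" for u
        unfolding power2_norm_eq_inner
        by (simp add: inner_add_left inner_add_right inner_commute[of u a] power2_eq_square
            distrib_left)
      from this[of "x - y"] show ?thesis using that by (simp add: norm_eq_1 algebra_simps)
    qed
    have "(norm (l *\<^sub>R d + x - y))\<^sup>2 \<le> (norm (z - y))\<^sup>2"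
      unfolding lx(2) expand[OF unit[OF d(1)]] expand[OF w] wc
      using d(2) lx(1) by (simp add: mult_left_mono)
    then have "norm (l *\<^sub>R d + x - y) \<le> norm (z - y)" by (simp add: power_mono_iff)
    \<comment> \<open>The vertex \<open>d\<close> may already belong to \<open>T'\<close>; in either
      case the support does not grow.\<close>
    moreover have "card (insert d T') \<le> k"
      using T(3) T' by (simp add: card_insert_if)
    then have "l *\<^sub>R d + x \<in> sparse_hull k V"
      using lx(4)[of d] d(1) T'(3,4) unfolding sparse_hull_eq_Union by blast
    ultimately show ?thesis using that by blast
  qed
qed

lemma sparse_projection_support:
  assumes "is_arg_min g (\<lambda>z. z \<in> sparse_hull k V) p"
  obtains T where "T \<subseteq> V" "finite T" "card T \<le> k" "p \<in> convex hull T"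
  using assms by (auto simp: is_arg_min_def sparse_hull_eq_Union)

subsection \<open>Runs of a deterministic method\<close>

lemma returns_from_cases:
  "returns_from M I h w m \<longleftrightarrow>
    (case M h of
       Return v \<Rightarrow> w = v \<and> m = 0
     | Project y \<Rightarrow> (\<exists>m'. m = Suc m' \<and> returns_from M I (h @ [Projection (proj_oracle I y)]) w m')
     | Evaluate x \<Rightarrow>
         returns_from M I (h @ [First_Order (objective I x) (gradient (objective I) x)]) w m)"
  by (subst returns_from.simps) (auto split: action.splits)

text \<open>Determinism: a run known to fail and a run covered by a guarantee are the same
  run.\<close>

lemma returns_from_unique:
  "returns_from M I h w m \<Longrightarrow> returns_from M I h w' m' \<Longrightarrow> w' = w \<and> m' = m"
proof (induction arbitrary: w' m' rule: returns_from.induct)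
  case (stop h w)
  then show ?case by (simp add: returns_from_cases[of _ _ h])
next
  case (project h y w m)
  from project.prems project.hyps(1) show ?case
    by (subst (asm) returns_from_cases) (auto dest: project.IH)
next
  case (evaluate h x w m)
  from evaluate.prems evaluate.hyps(1) show ?case
    by (subst (asm) returns_from_cases) (auto dest: evaluate.IH)
qed

text \<open>While \<open>returns_from\<close> covers only runs that stop, this covers finite initial
  segments, also of endless runs. Projection queries are collected in \<open>ys\<close>, newest
  first; first-order queries are not, since all problems compared share the objective.\<close>

inductive reaches ::
  "('n::finite) deterministic_method \<Rightarrow> 'n problem \<Rightarrow> (real ^ 'n) answer list
     \<Rightarrow> (real ^ 'n) list \<Rightarrow> bool"
  for M :: "('n::finite) deterministic_method" and I :: "'n problem" where
  start: "reaches M I [] []"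
| project: "reaches M I h ys \<Longrightarrow> M h = Project y
     \<Longrightarrow> reaches M I (h @ [Projection (proj_oracle I y)]) (y # ys)"
| evaluate: "reaches M I h ys \<Longrightarrow> M h = Evaluate x
     \<Longrightarrow> reaches M I (h @ [First_Order (objective I x) (gradient (objective I) x)]) ys"

text \<open>Both problems give the same answers along \<open>h\<close>, so the run against
  \<open>J\<close> passes through \<open>h\<close> after \<open>length ys\<close>
  projections.\<close>

lemma returns_iff_returns_from_reached:
  assumes "reaches M I h ys" and "objective J = objective I"
    and "\<And>y. y \<in> set ys \<Longrightarrow> proj_oracle J y = proj_oracle I y"
  shows "returns M J w m \<longleftrightarrow> (\<exists>m'. m = length ys + m' \<and> returns_from M J h w m')"
  using assms
proof (induction arbitrary: m rule: reaches.induct)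
  case start
  then show ?case by simp
next
  case (project h ys y)
  have "returns M J w m \<longleftrightarrow> (\<exists>m'. m = length ys + m' \<and> returns_from M J h w m')"
    using project by simp
  also have "\<dots> \<longleftrightarrow> (\<exists>m'. m = length (y # ys) + m' \<and>
      returns_from M J (h @ [Projection (proj_oracle I y)]) w m')"
    using project.hyps(2) project.prems by (subst returns_from_cases) auto
  finally show ?case .
next
  case (evaluate h ys x)
  have "returns M J w m \<longleftrightarrow> (\<exists>m'. m = length ys + m' \<and> returns_from M J h w m')"
    using evaluate by simp
  also have "\<dots> \<longleftrightarrow> (\<exists>m'. m = length ys + m' \<and>
      returns_from M J (h @ [First_Order (objective I x) (gradient (objective I) x)]) w m')"
    using evaluate.hyps(2) evaluate.prems by (subst returns_from_cases) auto
  finally show ?case .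
qed

text \<open>Until the next projection only the objective matters. The terminating run against
  \<open>J\<close> excludes an endless sequence of first-order calls.\<close>

lemma next_projection_or_return:
  assumes "returns_from M J h w m" and "reaches M I h ys" and "objective J = objective I"
  shows "(m = 0 \<and> (\<forall>J'. objective J' = objective I \<longrightarrow> returns_from M J' h w 0)) \<or>
    (m > 0 \<and> (\<exists>h' y. reaches M I h' (y # ys)))"
  using assms
proof (induction rule: returns_from.induct)
  case (stop h w)
  then show ?case by (auto intro: returns_from.stop)
next
  case (project h y w m)
  then show ?case using reaches.project by blast
next
  case (evaluate h x w m)
  then have "reaches M I (h @ [First_Order (objective J x) (gradient (objective J) x)]) ys"
    using reaches.evaluate by metis
  then have "(m = 0 \<and> (\<forall>J'. objective J' = objective I \<longrightarrow>
        returns_from M J' (h @ [First_Order (objective J x) (gradient (objective J) x)]) w 0)) \<or>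
      (m > 0 \<and> (\<exists>h' y. reaches M I h' (y # ys)))"
    using evaluate.IH evaluate.prems(2) by blast
  then show ?case
    using returns_from.evaluate[of M h x _ w 0] evaluate.hyps(1) evaluate.prems(2) by metis
qed

text \<open>\<open>I\<close> need not belong to the class \<open>C\<close>, so nothing guarantees that \<open>M\<close> stops on \<open>I\<close>. But every
  run with at most \<open>B\<close> projections against \<open>I\<close> is also a run against some member of \<open>C\<close>, where
  \<open>M\<close> stops; hence a run against \<open>I\<close> with the maximal number of projections must stop as well.\<close>

lemma returns_against_resisting_problem:
  fixes I :: "('n::finite) problem"
  assumes returns: "\<And>J. J \<in> C \<Longrightarrow> \<exists>w m. returns M J w m \<and> m \<le> B"
    and resist: "\<And>ys. length ys \<le> B \<Longrightarrow> \<exists>J\<in>C. objective J = objective I \<and>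
      (\<forall>y\<in>set ys. proj_oracle J y = proj_oracle I y)"
  obtains ys w where "length ys \<le> B"
    and "\<And>J. objective J = objective I \<Longrightarrow>
      (\<And>y. y \<in> set ys \<Longrightarrow> proj_oracle J y = proj_oracle I y) \<Longrightarrow> returns M J w (length ys)"
proof -
  define L where "L = {length ys | h ys. reaches M I h ys \<and> length ys \<le> B}"
  have "finite L" by (rule finite_subset[of _ "{..B}"]) (auto simp: L_def)
  moreover have "0 \<in> L" unfolding L_def using reaches.start[of M I] by force
  ultimately have "Max L \<in> L" and max: "\<And>n. n \<in> L \<Longrightarrow> n \<le> Max L"
    using Max_in by auto
  then obtain h ys where ys: "reaches M I h ys" "length ys \<le> B" "length ys = Max L"
    unfolding L_def by auto
  obtain J where J: "J \<in> C" "objective J = objective I"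
      "\<And>y. y \<in> set ys \<Longrightarrow> proj_oracle J y = proj_oracle I y"
    using resist[OF ys(2)] by blast
  obtain w m where "returns M J w m" "m \<le> B" using returns[OF J(1)] by blast
  then obtain m' where m': "returns_from M J h w m'" "length ys + m' \<le> B"
    using returns_iff_returns_from_reached[OF ys(1) J(2), of w m] J(3) by blast
  have "m' = 0"
  proof (rule ccontr)
    assume "m' \<noteq> 0"
    then obtain h' y where "reaches M I h' (y # ys)"
      using next_projection_or_return[OF m'(1) ys(1) J(2)] by blast
    then have "Suc (length ys) \<in> L"
      unfolding L_def using m'(2) \<open>m' \<noteq> 0\<close> by force
    then show False using max ys(3) by fastforce
  qed
  \<comment> \<open>The choice of \<open>J\<close> no longer matters: no projection follows
    \<open>h\<close>. Hence the hidden vertex may be chosen after the returned point is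
    known.\<close>
  then have "\<And>J'. objective J' = objective I \<Longrightarrow> returns_from M J' h w 0"
    using next_projection_or_return[OF m'(1) ys(1) J(2)] by blast
  then show ?thesis
    using returns_iff_returns_from_reached[OF ys(1)] by (intro that[OF ys(2), of w]) force
qed

subsection \<open>The quadratic objective\<close>

definition split_hessian :: "real \<Rightarrow> real \<Rightarrow> 'n::finite set \<Rightarrow> real ^ 'n \<Rightarrow> real ^ 'n" where
  "split_hessian \<alpha> \<beta> E x = (\<chi> i. (if i \<in> E then \<beta> else \<alpha>) * x $ i)"

text \<open>The factor 1/2 makes \<open>split_hessian\<close> both the Hessian and the
  gradient.\<close>

definition split_quadratic :: "real \<Rightarrow> real \<Rightarrow> 'n::finite set \<Rightarrow> real ^ 'n \<Rightarrow> real" where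
  "split_quadratic \<alpha> \<beta> E x = x \<bullet> split_hessian \<alpha> \<beta> E x / 2"

lemma split_hessian_nth [simp]:
  "split_hessian \<alpha> \<beta> E x $ i = (if i \<in> E then \<beta> else \<alpha>) * x $ i"
  by (simp add: split_hessian_def)

lemma linear_split_hessian: "linear (split_hessian \<alpha> \<beta> E)"
  by (rule linearI) (simp_all add: vec_eq_iff algebra_simps)

lemma inner_split_hessian_commute:
  "x \<bullet> split_hessian \<alpha> \<beta> E y = split_hessian \<alpha> \<beta> E x \<bullet> y"
  by (simp add: inner_vec_def algebra_simps)

text \<open>The Taylor expansion at \<open>x\<close>, exact for a quadratic; strong convexity and
  the optimality of the hidden vertex are both read off from it.\<close>

lemma split_quadratic_add:
  "split_quadratic \<alpha> \<beta> E (x + y) =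
    split_quadratic \<alpha> \<beta> E x + split_hessian \<alpha> \<beta> E x \<bullet> y + split_quadratic \<alpha> \<beta> E y"
proof -
  have "y \<bullet> split_hessian \<alpha> \<beta> E x = split_hessian \<alpha> \<beta> E x \<bullet> y"
    by (rule inner_commute)
  then show ?thesis
    unfolding split_quadratic_def linear_add[OF linear_split_hessian] inner_add_left inner_add_right
    by (simp add: inner_split_hessian_commute field_simps)
qed

lemma split_quadratic_scaleR:
  "split_quadratic \<alpha> \<beta> E (t *\<^sub>R x) = t\<^sup>2 * split_quadratic \<alpha> \<beta> E x"
  by (simp add: split_quadratic_def linear_scale[OF linear_split_hessian] power2_eq_square)

lemma split_quadratic_ge:
  assumes "\<alpha> \<le> \<beta>"
  shows "\<alpha> / 2 * (norm x)\<^sup>2 \<le> split_quadratic \<alpha> \<beta> E x"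
proof -
  have "\<alpha> * (x \<bullet> x) = (\<Sum>i\<in>UNIV. x $ i * (\<alpha> * x $ i))"
    by (simp add: inner_vec_def sum_distrib_left algebra_simps)
  also have "\<dots> \<le> (\<Sum>i\<in>UNIV. x $ i * ((if i \<in> E then \<beta> else \<alpha>) * x $ i))"
  proof (rule sum_mono)
    fix i
    have "\<alpha> * (x $ i)\<^sup>2 \<le> \<beta> * (x $ i)\<^sup>2" using assms by (rule mult_right_mono) simp
    then show "x $ i * (\<alpha> * x $ i) \<le> x $ i * ((if i \<in> E then \<beta> else \<alpha>) * x $ i)"
      by (simp add: power2_eq_square algebra_simps)
  qed
  finally show ?thesis
    by (simp add: split_quadratic_def power2_norm_eq_inner inner_vec_def)
qed

lemma norm_split_hessian_le:
  assumes "0 < \<alpha>" "\<alpha> \<le> \<beta>"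
  shows "norm (split_hessian \<alpha> \<beta> E x) \<le> \<beta> * norm x"
proof -
  have "norm (split_hessian \<alpha> \<beta> E x) \<le> norm (\<beta> *\<^sub>R x)"
    by (rule norm_le_componentwise_cart)
      (use assms in \<open>auto simp: abs_mult intro: mult_right_mono\<close>)
  then show ?thesis using assms by simp
qed

lemma quadratic_split_quadratic: "quadratic (split_quadratic \<alpha> \<beta> E)"
proof -
  define A :: "real ^ 'a ^ 'a" where
    "A = (\<chi> i j. if i = j then (if i \<in> E then \<beta> else \<alpha>) / 2 else 0)"
  have "(A *v x) $ i = ((1 / 2) *\<^sub>R split_hessian \<alpha> \<beta> E x) $ i" for x i
  proof -
    have "(A *v x) $ i = (\<Sum>j\<in>UNIV. if i = j then (if i \<in> E then \<beta> else \<alpha>) / 2 * x $ j else 0)"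
      unfolding A_def matrix_vector_mult_def vec_lambda_beta by (rule sum.cong) auto
    then show ?thesis by simp
  qed
  then have "A *v x = (1 / 2) *\<^sub>R split_hessian \<alpha> \<beta> E x" for x by (simp add: vec_eq_iff)
  then have "split_quadratic \<alpha> \<beta> E x = x \<bullet> (A *v x) + 0 \<bullet> x + 0" for x
    by (simp add: split_quadratic_def)
  then show ?thesis unfolding quadratic_def by blast
qed

lemma strongly_convex_split_quadratic:
  assumes "\<alpha> \<le> \<beta>"
  shows "strongly_convex \<alpha> (split_quadratic \<alpha> \<beta> E)"
  unfolding strongly_convex_def
proof (intro allI ballI)
  fix x y :: "real ^ 'a" and t :: real
  assume t: "t \<in> {0..1}"
  let ?f = "split_quadratic \<alpha> \<beta> E" and ?H = "split_hessian \<alpha> \<beta> E"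
  have x: "?f x = ?f y + ?H y \<bullet> (x - y) + ?f (x - y)"
    using split_quadratic_add[of \<alpha> \<beta> E y "x - y"] by simp
  have "?f (t *\<^sub>R x + (1 - t) *\<^sub>R y) = ?f (y + t *\<^sub>R (x - y))"
    by (simp add: algebra_simps)
  also have "\<dots> = ?f y + t * (?H y \<bullet> (x - y)) + t\<^sup>2 * ?f (x - y)"
    by (simp only: split_quadratic_add split_quadratic_scaleR inner_scaleR_right)
  also have "\<dots> = t * ?f x + (1 - t) * ?f y - t * (1 - t) * ?f (x - y)"
    unfolding x by (simp add: algebra_simps power2_eq_square)
  also have "\<dots> \<le> t * ?f x + (1 - t) * ?f y - t * (1 - t) * (\<alpha> / 2 * (norm (x - y))\<^sup>2)"
    using mult_left_mono[OF split_quadratic_ge[OF assms, of "x - y" E], of "t * (1 - t)"] t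
    by simp
  finally show "?f (t *\<^sub>R x + (1 - t) *\<^sub>R y)
      \<le> t * ?f x + (1 - t) * ?f y - \<alpha> / 2 * t * (1 - t) * (norm (x - y))\<^sup>2"
    by (simp add: algebra_simps)
qed

lemma GDERIV_split_quadratic: "GDERIV (split_quadratic \<alpha> \<beta> E) x :> split_hessian \<alpha> \<beta> E x"
proof -
  have "(split_hessian \<alpha> \<beta> E has_derivative split_hessian \<alpha> \<beta> E) (at x)"
    using linear_split_hessian by (rule linear_imp_has_derivative)
  then have "((\<lambda>x. (1 / 2) *\<^sub>R (x \<bullet> split_hessian \<alpha> \<beta> E x)) has_derivative
      (\<lambda>h. (1 / 2) *\<^sub>R (x \<bullet> split_hessian \<alpha> \<beta> E h + h \<bullet> split_hessian \<alpha> \<beta> E x))) (at x)"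
    by (intro has_derivative_scaleR_right has_derivative_inner has_derivative_ident)
  moreover have "x \<bullet> split_hessian \<alpha> \<beta> E h = h \<bullet> split_hessian \<alpha> \<beta> E x" for h
    unfolding inner_split_hessian_commute[of x] by (rule inner_commute)
  ultimately show ?thesis
    unfolding gderiv_def split_quadratic_def[abs_def] by simp
qed

lemma gradient_split_quadratic: "gradient (split_quadratic \<alpha> \<beta> E) = split_hessian \<alpha> \<beta> E"
proof
  fix x :: "real ^ 'a"
  have "g = split_hessian \<alpha> \<beta> E x" if "GDERIV (split_quadratic \<alpha> \<beta> E) x :> g" for g
  proof -
    have "(\<lambda>h. h \<bullet> g) = (\<lambda>h. h \<bullet> split_hessian \<alpha> \<beta> E x)"
      using that GDERIV_split_quadratic[of \<alpha> \<beta> E x] unfolding gderiv_def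
      by (rule has_derivative_unique)
    then show ?thesis by (metis vector_eq_ldot)
  qed
  then show "gradient (split_quadratic \<alpha> \<beta> E) x = split_hessian \<alpha> \<beta> E x"
    unfolding gradient_def using GDERIV_split_quadratic by blast
qed

lemma smooth_split_quadratic:
  assumes "0 < \<alpha>" "\<alpha> \<le> \<beta>"
  shows "smooth \<beta> (split_quadratic \<alpha> \<beta> E)"
  unfolding smooth_def
proof (intro conjI allI)
  show "split_quadratic \<alpha> \<beta> E differentiable at x" for x
    using GDERIV_split_quadratic[of \<alpha> \<beta> E x] unfolding gderiv_def differentiable_def by blast
  show "\<beta>-lipschitz_on UNIV (gradient (split_quadratic \<alpha> \<beta> E))"
  proof (rule lipschitz_onI)
    show "dist (gradient (split_quadratic \<alpha> \<beta> E) x) (gradient (split_quadratic \<alpha> \<beta> E) y)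
        \<le> \<beta> * dist x y" for x y
      unfolding gradient_split_quadratic dist_norm linear_diff[OF linear_split_hessian, symmetric]
      by (rule norm_split_hessian_le[OF assms])
  qed (use assms in simp)
qed

subsection \<open>The hidden vertex\<close>

text \<open>With weight t on the barycentre of \<open>S\<close> and 1 - t on that of
  \<open>E\<close>, a coordinate in \<open>S\<close> exceeds the squared norm by t (1 - t) (1/|S| -
  1/|E|). This slack is largest at t = 1/2.\<close>

definition halfway_centre :: "'n::finite set \<Rightarrow> 'n set \<Rightarrow> real ^ 'n" where
  "halfway_centre S E =
    (\<chi> i. indicator S i / (2 * real (card S)) + indicator E i / (2 * real (card E)))"

lemma halfway_centre_in_hull:
  assumes "S \<subseteq> E" "S \<noteq> {}"
  shows "halfway_centre S E \<in> convex hull ((\<lambda>i. axis i 1) ` E)"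
proof -
  let ?c = "halfway_centre S E"
  have card: "0 < card S" "0 < card E"
    using assms by (auto simp: card_gt_0_iff)
  have "sum (indicator S) E = real (card S)"
    using assms(1) by (simp add: indicator_def sum.If_cases Int_absorb1)
  then have one: "(\<Sum>i\<in>E. ?c $ i) = 1"
    using card assms by (auto simp: halfway_centre_def sum.distrib simp flip: sum_divide_distrib)
  have "?c = (\<Sum>i\<in>UNIV. ?c $ i *\<^sub>R axis i 1)"
    using basis_expansion[of ?c] by (simp add: scalar_mult_eq_scaleR)
  also have "\<dots> = (\<Sum>i\<in>E. ?c $ i *\<^sub>R axis i 1)"
    using assms(1) by (intro sum.mono_neutral_right) (auto simp: halfway_centre_def indicator_def)
  also have "\<dots> \<in> convex hull ((\<lambda>i. axis i 1) ` E)"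
    by (rule convex_sum)
      (use one in \<open>auto simp: halfway_centre_def hull_inc\<close>)
  finally show ?thesis .
qed

lemma halfway_centre_inner_self:
  assumes "S \<subseteq> E" "S \<noteq> {}"
  shows "halfway_centre S E \<bullet> halfway_centre S E = (1 / card S + 3 / card E) / 4"
proof -
  let ?s = "1 / (2 * real (card S))" and ?e = "1 / (2 * real (card E))"
  have card: "0 < card S" "0 < card E"
    using assms by (auto simp: card_gt_0_iff)
  \<comment> \<open>Indicators are idempotent, and the product of the two is that of
    \<open>S\<close>.\<close>
  have "halfway_centre S E \<bullet> halfway_centre S E =
      (\<Sum>i\<in>UNIV. indicator S i * (?s\<^sup>2 + 2 * ?s * ?e) + indicator E i * ?e\<^sup>2)"
    using assms(1) unfolding inner_vec_def halfway_centre_def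
    by (intro sum.cong) (auto simp: indicator_def power2_eq_square algebra_simps)
  also have "\<dots> = card S * (?s\<^sup>2 + 2 * ?s * ?e) + card E * ?e\<^sup>2"
    by (simp add: sum.distrib indicator_def flip: sum_distrib_right)
  also have "\<dots> = (1 / card S + 3 / card E) / 4"
    using card assms by (auto simp: field_simps power2_eq_square)
  finally show ?thesis .
qed

text \<open>A dimension count leaves a direction orthogonal to \<open>X\<close> and to all unit
  vectors of \<open>E\<close>, hence to \<open>c\<close>. Scaled to squared length 1 - |c|^2 and
  added to \<open>c\<close>, it yields a unit vector by Pythagoras.\<close>

lemma hidden_vertex_exists:
  fixes X :: "(real ^ 'n::finite) set"
  assumes "finite X" "card X + card E < CARD('n)" "norm c \<le> 1"
    and c: "c \<in> span ((\<lambda>i. axis i 1) ` E)"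
  obtains w where "norm w = 1" "\<And>i. i \<in> E \<Longrightarrow> orthogonal (w - c) (axis i 1)"
    "\<And>x. x \<in> X \<Longrightarrow> orthogonal (w - c) x"
proof -
  let ?Z = "X \<union> (\<lambda>i. axis i 1) ` E"
  have "dim ?Z \<le> card ?Z" by (rule dim_le_card') (use assms(1) in simp)
  also have "\<dots> \<le> card X + card E"
    by (rule order_trans[OF card_Un_le]) (simp add: card_image_le)
  also have "\<dots> < DIM(real ^ 'n)" using assms(2) by simp
  finally obtain h0 where h0: "h0 \<noteq> 0" "\<And>z. z \<in> span ?Z \<Longrightarrow> orthogonal h0 z"
    using orthogonal_to_subspace_exists by blast
  define h where "h = (sqrt (1 - c \<bullet> c) / norm h0) *\<^sub>R h0"
  have h: "orthogonal h z" if "z \<in> span ?Z" for z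
    using h0(2)[OF that] by (simp add: h_def orthogonal_def)
  have "c \<bullet> c \<le> 1" using assms(3) by (simp add: power_le_one flip: power2_norm_eq_inner)
  then have hh: "h \<bullet> h = 1 - c \<bullet> c"
    using h0(1) by (simp add: h_def power2_eq_square flip: power2_norm_eq_inner)
  have "h \<bullet> c = 0"
    using h[of c] c span_mono[of "(\<lambda>i. axis i 1) ` E" ?Z] by (auto simp: orthogonal_def)
  then have "(c + h) \<bullet> (c + h) = 1"
    using hh by (simp add: inner_add_left inner_add_right inner_commute)
  then have "norm (c + h) = 1" by (simp add: norm_eq_1)
  then show ?thesis
    using h by (intro that[of "c + h"]) (auto simp: span_base)
qed

text \<open>As \<open>c\<close> lives on \<open>E\<close> and \<open>h\<close> off \<open>E\<close>,
  the gradient at \<open>w\<close> is \<beta> c + \<alpha> h. Moving to a revealed vertex gains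
  \<beta> (1/|S| - 1/|E|) / 4 from the first part and loses \<alpha> |h|^2, at most \<alpha>, from
  the second; \<open>cond\<close> balances them.\<close>

lemma hidden_vertex_optimal:
  fixes E S :: "'n::finite set"
  defines "c \<equiv> halfway_centre S E"
  assumes "0 < \<alpha>" "\<alpha> \<le> \<beta>" and S: "S \<subseteq> E" "S \<noteq> {}"
    and cond: "4 * \<alpha> \<le> \<beta> * (1 / card S - 1 / card E)"
    and w: "norm w = 1" and orth: "\<And>i. i \<in> E \<Longrightarrow> orthogonal (w - c) (axis i 1)"
    and q: "q \<in> convex hull (insert w ((\<lambda>i. axis i 1) ` S))"
  shows "\<alpha> / 2 * (norm (q - w))\<^sup>2 \<le> split_quadratic \<alpha> \<beta> E q - split_quadratic \<alpha> \<beta> E w"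
proof -
  let ?H = "split_hessian \<alpha> \<beta> E"
  define h where "h = w - c"
  have h0: "h $ i = 0" if "i \<in> E" for i
    using orth[OF that] by (simp add: h_def orthogonal_def inner_axis)
  have c0: "c $ i = 0" if "i \<notin> E" for i
    using that S(1) by (auto simp: c_def halfway_centre_def indicator_def)
  have wch: "w = c + h" by (simp add: h_def)
  have "c $ i \<bullet> h $ i = 0" for i using h0 c0 by (cases "i \<in> E") auto
  then have ch: "c \<bullet> h = 0" unfolding inner_vec_def by (intro sum.neutral) blast
  have Hw: "?H w = \<beta> *\<^sub>R c + \<alpha> *\<^sub>R h"
    by (simp add: vec_eq_iff wch h0 c0 algebra_simps)
  have hh: "c \<bullet> c + h \<bullet> h = 1"
    using w ch unfolding norm_eq_1 wch by (simp add: inner_add_left inner_add_right inner_commute)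
  have Hww: "?H w \<bullet> w = \<beta> * (c \<bullet> c) + \<alpha> * (h \<bullet> h)"
    unfolding Hw unfolding wch
    using ch by (simp add: inner_add_left inner_add_right inner_commute)
  have cc: "c \<bullet> c = (1 / card S + 3 / card E) / 4"
    unfolding c_def using S by (rule halfway_centre_inner_self)
  have "?H w \<bullet> w \<le> ?H w \<bullet> axis i 1" if "i \<in> S" for i
  proof -
    have i: "i \<in> E" using that S by blast
    have "?H w \<bullet> axis i 1 = \<beta> * c $ i"
      unfolding inner_axis Hw using h0[OF i] by simp
    also have "c $ i = c \<bullet> c + (1 / card S - 1 / card E) / 4"
      unfolding cc using that i by (simp add: c_def halfway_centre_def field_simps)
    also have "\<beta> * \<dots> = \<beta> * (c \<bullet> c) + \<beta> * (1 / card S - 1 / card E) / 4"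
      by (simp add: algebra_simps)
    also have "\<dots> \<ge> \<beta> * (c \<bullet> c) + \<alpha>" using cond by simp
    moreover have "\<alpha> * (h \<bullet> h) \<le> \<alpha>"
      using hh \<open>0 < \<alpha>\<close> inner_ge_zero[of c] by (intro mult_left_le) linarith+
    ultimately show ?thesis unfolding Hww by linarith
  qed
  then have "insert w ((\<lambda>i. axis i 1) ` S) \<subseteq> {x. ?H w \<bullet> x \<ge> ?H w \<bullet> w}" by auto
  then have "convex hull (insert w ((\<lambda>i. axis i 1) ` S)) \<subseteq> {x. ?H w \<bullet> x \<ge> ?H w \<bullet> w}"
    by (rule hull_minimal) (rule convex_halfspace_ge)
  then have "?H w \<bullet> (q - w) \<ge> 0" using q by (auto simp: inner_diff_right)
  then show ?thesis
    using split_quadratic_add[of \<alpha> \<beta> E w "q - w"] split_quadratic_ge[OF \<open>\<alpha> \<le> \<beta>\<close>, of "q - w" E]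
    by simp
qed

lemma resisting_instance_exists:
  fixes P :: "real ^ 'n::finite \<Rightarrow> real ^ 'n" and v :: "real ^ 'n"
  assumes "0 < \<alpha>" and kappa: "16 * real N * \<alpha> \<le> \<beta>" and N: "5 \<le> N"
    and n: "CARD('n) = 6 * N" and E: "card E = 4 * N" and "1 \<le> k"
    and P: "\<And>y. is_arg_min (\<lambda>z. norm (z - y)) (\<lambda>z. z \<in> sparse_hull k ((\<lambda>i. axis i 1) ` E)) (P y)"
    and ys: "k * length ys < N"
  shows "\<exists>I\<in>instances \<alpha> \<beta> k. objective I = split_quadratic \<alpha> \<beta> E \<and>
    (\<forall>y\<in>set ys. proj_oracle I y = P y) \<and>
    (\<exists>w. minimizer I w \<and> (v \<in> feasible I \<longrightarrow> \<alpha> / 4 \<le> objective I v - objective I w))"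
proof -
  let ?f = "split_quadratic \<alpha> \<beta> E" and ?ax = "\<lambda>i. axis i 1 :: real ^ 'n"
  have "1 * \<alpha> \<le> 16 * real N * \<alpha>" using N \<open>0 < \<alpha>\<close> by (intro mult_right_mono) auto
  then have "\<alpha> \<le> \<beta>" using kappa by simp
  have "\<exists>T\<subseteq>E. card T \<le> k \<and> P y \<in> convex hull (?ax ` T)" for y
  proof -
    obtain T where T: "T \<subseteq> ?ax ` E" "finite T" "card T \<le> k" "P y \<in> convex hull T"
      using sparse_projection_support[OF P] .
    moreover have "inj_on ?ax E" by (auto simp: inj_on_def axis_eq_axis)
    ultimately obtain T' where "T' \<subseteq> E" "T = ?ax ` T'" "card T' = card T"
      by (metis subset_image_inj card_image)
    then show ?thesis using T by auto
  qed
  then obtain T where T: "\<And>y. T y \<subseteq> E" "\<And>y. card (T y) \<le> k" "\<And>y. P y \<in> convex hull (?ax ` T y)"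
    by metis
  \<comment> \<open>The extra index keeps \<open>S\<close> nonempty when nothing was revealed; the
    strict bound in \<open>ys\<close> leaves room for it within \<open>N\<close>.\<close>
  obtain i0 where "i0 \<in> E" using E N by fastforce
  define S where "S = insert i0 (\<Union>y\<in>set ys. T y)"
  have S: "S \<subseteq> E" "S \<noteq> {}" using T(1) \<open>i0 \<in> E\<close> by (auto simp: S_def)
  have "card (\<Union>y\<in>set ys. T y) \<le> (\<Sum>y\<in>set ys. card (T y))" by (rule card_UN_le) simp
  also have "\<dots> \<le> card (set ys) * k"
    using sum_bounded_above[of "set ys" "\<lambda>y. card (T y)" k] T(2) by simp
  also have "\<dots> \<le> length ys * k" by (intro mult_right_mono card_length) simp
  finally have "card S \<le> N"
    using ys card_insert_le_m1[of N "\<Union>y\<in>set ys. T y" i0]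
    by (simp add: S_def card_insert_if mult.commute)
  moreover have "0 < card S" using S(2) by (simp add: card_gt_0_iff)
  ultimately have inv: "1 / real N \<le> 1 / card S" "1 / card S \<le> 1" by (simp_all add: field_simps)
  have cond: "4 * \<alpha> \<le> \<beta> * (1 / card S - 1 / card E)"
  proof -
    \<comment> \<open>With |S| at most N and |E| = 4N the bracket is at least 3/(4N), which gives 12
      \<alpha>.\<close>
    have "4 * \<alpha> \<le> 16 * real N * \<alpha> * (3 / (4 * real N))" using N \<open>0 < \<alpha>\<close> by simp
    also have "\<dots> \<le> \<beta> * (3 / (4 * real N))" by (intro mult_right_mono kappa) simp
    also have "\<dots> \<le> \<beta> * (1 / card S - 1 / card E)"
      using inv(1) \<open>0 < \<alpha>\<close> \<open>\<alpha> \<le> \<beta>\<close> by (intro mult_left_mono) (simp_all add: E)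
    finally show ?thesis .
  qed
  define c where "c = halfway_centre S E"
  have c: "c \<in> convex hull (?ax ` E)"
    unfolding c_def using S by (rule halfway_centre_in_hull)
  \<comment> \<open>This leaves the component of \<open>w\<close> orthogonal to the simplex a
    squared length of at least 1/2, the source of the gap \<alpha>/4.\<close>
  have "3 / card E \<le> 1" using N by (simp add: E)
  then have cc: "c \<bullet> c \<le> 1 / 2"
    using inv(2) add_mono[of "1 / real (card S)" 1 "3 / real (card E)" 1]
    unfolding c_def halfway_centre_inner_self[OF S] by simp
  then have "norm c \<le> 1" by (simp add: norm_le_square)
  \<comment> \<open>Outside \<open>E\<close> there are 2N dimensions, against at most N vectors to
    avoid.\<close>
  have "card (insert v (set ys)) \<le> Suc (length ys)"
    by (rule order_trans[OF card_insert_le_m1]) (auto intro: card_length)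
  moreover have "length ys \<le> k * length ys" using \<open>1 \<le> k\<close> by simp
  ultimately have "card (insert v (set ys)) + card E < CARD('n)"
    using ys N unfolding n E by linarith
  then obtain w where w: "norm w = 1" and worth: "\<And>i. i \<in> E \<Longrightarrow> orthogonal (w - c) (?ax i)"
    and wy: "\<And>x. x \<in> insert v (set ys) \<Longrightarrow> orthogonal (w - c) x"
    using hidden_vertex_exists[of "insert v (set ys)" E c] \<open>norm c \<le> 1\<close> c convex_hull_subset_span
    by blast
  \<comment> \<open>Unit vectors in \<open>E\<close> outside \<open>S\<close> must be dropped: from
    \<open>w\<close> the objective initially decreases towards them.\<close>
  define V where "V = insert w (?ax ` S)"
  have V: "finite V" "V \<noteq> {}" "w \<in> V" by (auto simp: V_def)
  have Vunit: "norm x = 1" if "x \<in> V" for x using that w by (auto simp: V_def norm_axis_1)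
  define K where "K = convex hull V"
  have vertK: "vertices K = V"
    unfolding K_def using Vunit by (rule vertices_convex_hull_unit_vectors)
  have opt: "\<alpha> / 2 * (norm (q - w))\<^sup>2 \<le> ?f q - ?f w" if "q \<in> K" for q
    using hidden_vertex_optimal[OF \<open>0 < \<alpha>\<close> \<open>\<alpha> \<le> \<beta>\<close> S cond w] worth that
    unfolding K_def V_def c_def by blast
  \<comment> \<open>Nearest points may be tied, so the tie-breaking rule is set to give
    \<open>P y\<close> at the queries; elsewhere any nearest point will do.\<close>
  define Q where "Q y = (if y \<in> set ys then P y
      else SOME z. is_arg_min (\<lambda>z. norm (z - y)) (\<lambda>z. z \<in> sparse_hull k V) z)" for y
  define I where "I = \<lparr>objective = ?f, feasible = K, proj_oracle = Q\<rparr>"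
  have min: "minimizer I w' \<longleftrightarrow> w' = w" for w'
  proof -
    have "w \<in> K" using V(3) by (simp add: K_def hull_inc)
    moreover have "?f w < ?f q" if "q \<in> K" "q \<noteq> w" for q
    proof -
      have "0 < \<alpha> / 2 * (norm (q - w))\<^sup>2" using that(2) \<open>0 < \<alpha>\<close> by simp
      then show ?thesis using opt[OF that(1)] by linarith
    qed
    ultimately show ?thesis
      unfolding minimizer_def is_arg_min_linorder I_def problem.simps
      by (metis less_imp_le not_less order_refl)
  qed
  have proj: "sparse_projection_oracle k K Q"
    unfolding sparse_projection_oracle_def vertK
  proof
    fix y
    show "is_arg_min (\<lambda>z. norm (z - y)) (\<lambda>z. z \<in> sparse_hull k V) (Q y)"
    proof (cases "y \<in> set ys")
      case False
      then show ?thesis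
        unfolding Q_def using someI_ex[OF sparse_projection_exists[OF V(1,2) \<open>1 \<le> k\<close>]] by simp
    next
      case True
      have "?ax ` T y \<subseteq> V" using True by (auto simp: V_def S_def)
      moreover have "card (?ax ` T y) \<le> k" using card_image_le[of "T y" ?ax] T(2)[of y] by simp
      ultimately have "P y \<in> sparse_hull k V"
        using T(3)[of y] unfolding sparse_hull_eq_Union by (intro UN_I[of "?ax ` T y"]) auto
      moreover have "norm (P y - y) \<le> norm (z - y)" if "z \<in> sparse_hull k V" for z
      proof -
        \<comment> \<open>The exchange needs \<open>c\<close> in the hull of the vertices, and
          \<open>c\<close> involves all of \<open>E\<close>. Minimality is therefore shown over the
          larger set.\<close>
        have "V \<subseteq> insert w (?ax ` E)" using S(1) by (auto simp: V_def)
        then have z: "z \<in> sparse_hull k (insert w (?ax ` E))"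
          using that unfolding sparse_hull_eq_Union by (elim UN_E, intro UN_I) auto
        obtain z' where "z' \<in> sparse_hull k (?ax ` E)" "norm (z' - y) \<le> norm (z - y)"
        proof (rule sparse_hull_replace_unit_vector[OF _ w c _ _ z])
          show "orthogonal (w - c) y" using wy True by simp
        qed (use worth in \<open>auto simp: norm_axis_1\<close>)
        moreover from this(1) have "norm (P y - y) \<le> norm (z' - y)"
          using P[of y] by (simp add: is_arg_min_linorder)
        ultimately show ?thesis by linarith
      qed
      ultimately show ?thesis using True by (simp add: Q_def is_arg_min_linorder)
    qed
  qed
  have "K \<subseteq> cball 0 1"
    unfolding K_def by (rule hull_minimal) (auto simp: Vunit)
  then have "diameter K \<le> 2"
    using diameter_subset[of K "cball 0 1"] by simp
  moreover have "compact K" "convex K"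
    using V(1) by (simp_all add: K_def finite_imp_compact_convex_hull)
  ultimately have "I \<in> instances \<alpha> \<beta> k"
    using V(3) proj unfolding instances_def mem_Collect_eq min
    by (simp add: I_def vertK quadratic_split_quadratic
        strongly_convex_split_quadratic[OF \<open>\<alpha> \<le> \<beta>\<close>] smooth_split_quadratic[OF \<open>0 < \<alpha>\<close> \<open>\<alpha> \<le> \<beta>\<close>])
  moreover have "\<alpha> / 4 \<le> ?f v - ?f w" if "v \<in> K"
  proof -
    \<comment> \<open>The test direction is \<open>w - c\<close>, along which \<open>v\<close>
      vanishes and \<open>w\<close> has component 1 - |c|^2, the squared length of
      \<open>w - c\<close>. Cauchy-Schwarz bounds the distance from \<open>v\<close> to
      \<open>w\<close> below.\<close>
    have "(w - c) \<bullet> c = 0"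
    proof -
      have "orthogonal (w - c) c"
        using c convex_hull_subset_span worth by (intro orthogonal_to_span[of c "?ax ` E"]) auto
      then show ?thesis by (simp add: orthogonal_def)
    qed
    moreover have "(w - c) \<bullet> v = 0" using wy by (simp add: orthogonal_def)
    moreover have "w \<bullet> w = 1" using w by (simp add: norm_eq_1)
    ultimately have "1 - c \<bullet> c = (w - c) \<bullet> (w - v)" and "(w - c) \<bullet> (w - c) = 1 - c \<bullet> c"
      by (simp_all add: inner_diff_left inner_diff_right inner_commute)
    then have "(1 - c \<bullet> c)\<^sup>2 \<le> (1 - c \<bullet> c) * (norm (v - w))\<^sup>2"
      using Cauchy_Schwarz_ineq[of "w - c" "w - v"]
      by (simp add: norm_minus_commute flip: power2_norm_eq_inner[of "w - v"])
    then have "1 / 2 \<le> (norm (v - w))\<^sup>2" using cc by (simp add: power2_eq_square)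
    then have "\<alpha> / 2 * (1 / 2) \<le> \<alpha> / 2 * (norm (v - w))\<^sup>2"
      using \<open>0 < \<alpha>\<close> by (intro mult_left_mono) auto
    then show ?thesis using opt[OF that] by simp
  qed
  moreover have "objective I = ?f" "feasible I = K" "\<forall>y\<in>set ys. proj_oracle I y = P y"
    by (simp_all add: I_def Q_def)
  moreover have "minimizer I w" by (simp add: min)
  ultimately show ?thesis by metis
qed

subsection \<open>The lower bound\<close>

lemma budgeted_method_fails:
  fixes M :: "'n::finite deterministic_method"
  assumes "0 < \<alpha>" "16 * real N * \<alpha> \<le> \<beta>" "5 \<le> N" and n: "CARD('n) = 6 * N" and "1 \<le> k"
    and M: "\<And>I. I \<in> instances \<alpha> \<beta> k \<Longrightarrow> \<exists>w m. returns M I w m \<and> m \<le> N div (4 * k)"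
  shows "\<exists>I\<in>instances \<alpha> \<beta> k. \<exists>w_star w m. minimizer I w_star \<and> returns M I w m \<and>
    (w \<notin> feasible I \<or> objective I w - objective I w_star \<ge> \<alpha> / 4)"
proof -
  obtain E :: "'n set" where E: "card E = 4 * N"
    using obtain_subset_with_card_n[of "4 * N" "UNIV :: 'n set"] n by auto
  then have "E \<noteq> {}" using \<open>5 \<le> N\<close> by auto
  then have "\<exists>z. is_arg_min (\<lambda>z. norm (z - y))
      (\<lambda>z. z \<in> sparse_hull k ((\<lambda>i. axis i 1) ` E)) z" for y :: "real ^ 'n"
    using \<open>1 \<le> k\<close> by (intro sparse_projection_exists) auto
  then obtain P :: "real ^ 'n \<Rightarrow> real ^ 'n" where P: "\<And>y. is_arg_min (\<lambda>z. norm (z - y))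
      (\<lambda>z. z \<in> sparse_hull k ((\<lambda>i. axis i 1) ` E)) (P y)"
    by metis
  \<comment> \<open>Only the objective and the answers of \<open>I0\<close> are ever consulted, so
    its feasible set is left empty.\<close>
  define I0 where
    "I0 = \<lparr>objective = split_quadratic \<alpha> \<beta> E, feasible = {}, proj_oracle = P\<rparr>"
  \<comment> \<open>Used twice: with \<open>v\<close> ignored, to make the method stop against
    \<open>I0\<close>; then with \<open>v\<close> the point it returned.\<close>
  have resist: "\<exists>I\<in>instances \<alpha> \<beta> k. objective I = objective I0 \<and>
      (\<forall>y\<in>set ys. proj_oracle I y = proj_oracle I0 y) \<and>
      (\<exists>w. minimizer I w \<and> (v \<in> feasible I \<longrightarrow> \<alpha> / 4 \<le> objective I v - objective I w))"
    if "length ys \<le> N div (4 * k)" for ys v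
  proof -
    have "length ys * (4 * k) \<le> N"
      using that \<open>1 \<le> k\<close> by (simp add: less_eq_div_iff_mult_less_eq)
    then have "4 * (k * length ys) \<le> N" by (simp add: algebra_simps)
    then have "k * length ys < N" using \<open>5 \<le> N\<close> by linarith
    then show ?thesis
      unfolding I0_def problem.select_convs
      by (rule resisting_instance_exists[OF assms(1-3) n E \<open>1 \<le> k\<close> P])
  qed
  obtain ys w where ys: "length ys \<le> N div (4 * k)"
    and run: "\<And>I. objective I = objective I0 \<Longrightarrow>
      (\<And>y. y \<in> set ys \<Longrightarrow> proj_oracle I y = proj_oracle I0 y) \<Longrightarrow> returns M I w (length ys)"
  proof (rule returns_against_resisting_problem[of "instances \<alpha> \<beta> k" M "N div (4 * k)" I0])
    show "\<exists>I\<in>instances \<alpha> \<beta> k. objective I = objective I0 \<and>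
        (\<forall>y\<in>set ys. proj_oracle I y = proj_oracle I0 y)" if "length ys \<le> N div (4 * k)" for ys
      using resist[OF that] by blast
  qed (use M in blast)+
  obtain I where "I \<in> instances \<alpha> \<beta> k" "objective I = objective I0"
      "\<And>y. y \<in> set ys \<Longrightarrow> proj_oracle I y = proj_oracle I0 y"
      "\<exists>w_star. minimizer I w_star \<and> (w \<in> feasible I \<longrightarrow> \<alpha> / 4 \<le> objective I w - objective I w_star)"
    using resist[OF ys, of w] by blast
  then show ?thesis using run[of I] by blast
qed

lemma eps_optimal_iff_minimizer:
  assumes "minimizer I w_star"
  shows "eps_optimal \<epsilon> I w \<longleftrightarrow> w \<in> feasible I \<and> objective I w - objective I w_star \<le> \<epsilon>"
proof -
  have "(INF x\<in>feasible I. objective I x) = objective I w_star"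
    using assms unfolding minimizer_def is_arg_min_linorder
    by (intro cInf_eq_minimum) auto
  then show ?thesis by (simp add: eps_optimal_def)
qed

text \<open>Rounding in \<open>N\<close> costs less than 16, so \<kappa> < 16N + 21. If 4mk were at
  least N + 1, then 85mk would be at least 21.25 (N + 1), which exceeds 16N + 21.\<close>

lemma oracle_budget_arithmetic:
  fixes \<kappa> :: real
  assumes N: "N = nat \<lfloor>(\<kappa> - 5) / 16\<rfloor>" and "1 \<le> k" and m: "real m < 1 / 85 * (\<kappa> / real k)"
  shows "m \<le> N div (4 * k)"
proof -
  have "real (m * k) < \<kappa> / 85" using m \<open>1 \<le> k\<close> by (simp add: field_simps)
  moreover have "\<kappa> < 16 * real N + 21"
  proof -
    have "real_of_int \<lfloor>(\<kappa> - 5) / 16\<rfloor> \<le> real N" unfolding N by simp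
    then have "(\<kappa> - 5) / 16 < real N + 1"
      by (rule less_le_trans[OF real_of_int_floor_add_one_gt add_right_mono])
    then show ?thesis by (simp add: field_simps)
  qed
  ultimately have "real (85 * (m * k)) < real (16 * N + 21)" by simp
  then have "85 * (m * k) < 16 * N + 21" by (simp only: of_nat_less_iff)
  then have "4 * (m * k) \<le> N" by linarith
  then show ?thesis
    using \<open>1 \<le> k\<close> by (simp add: less_eq_div_iff_mult_less_eq algebra_simps)
qed

theorem theorem3:
  fixes \<alpha> \<beta> \<kappa> :: real and N :: nat
  assumes "\<alpha> > 0" and "\<beta> > 0"
    and "\<kappa> = \<beta> / \<alpha>"
    and "N = nat \<lfloor>(\<kappa> - 5) / 16\<rfloor>"
    and "\<kappa> \<ge> 85"
    and "CARD('n::finite) = 6 * N"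
  shows "\<forall>k. 1 \<le> k \<and> k \<le> 6 * N \<longrightarrow>
     (\<forall>M :: 'n deterministic_method.
        (\<forall>I \<in> instances \<alpha> \<beta> k. \<exists>w m. returns M I w m \<and> m \<le> N div (4 * k)) \<longrightarrow>
        (\<exists>I \<in> instances \<alpha> \<beta> k. \<exists>w_star w m.
           minimizer I w_star \<and> returns M I w m \<and>
           (w \<notin> feasible I \<or> objective I w - objective I w_star \<ge> \<alpha> / 4))) \<and>
     (\<forall>M :: 'n deterministic_method.
        (\<forall>I \<in> instances \<alpha> \<beta> k. \<exists>w m. returns M I w m \<and> eps_optimal (\<alpha> / 8) I w) \<longrightarrow>
        (\<exists>I \<in> instances \<alpha> \<beta> k. \<exists>w m.
           returns M I w m \<and> real m \<ge> 1 / 85 * (\<beta> / (\<alpha> * real k))))"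
proof (intro allI impI conjI; elim conjE)
  define F where "F = \<lfloor>(\<kappa> - 5) / 16\<rfloor>"
  \<comment> \<open>Here 85 = 16 * 5 + 5; in particular \<open>nat\<close> truncates
    nothing.\<close>
  have "5 \<le> F" using assms(5) by (simp add: F_def le_floor_iff)
  moreover have "real_of_int F \<le> (\<kappa> - 5) / 16" unfolding F_def by (rule of_int_floor_le)
  moreover have "N = nat F" using assms(4) by (simp add: F_def)
  ultimately have N: "5 \<le> N" "16 * real N \<le> \<kappa>" by simp_all
  then have "16 * real N * \<alpha> \<le> \<beta>"
    using assms(1,3) by (simp add: field_simps)
  note fails = budgeted_method_fails[OF assms(1) this N(1) assms(6)]
  show "\<exists>I\<in>instances \<alpha> \<beta> k. \<exists>w_star w m. minimizer I w_star \<and> returns M I w m \<and>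
      (w \<notin> feasible I \<or> objective I w - objective I w_star \<ge> \<alpha> / 4)"
    if "\<forall>I\<in>instances \<alpha> \<beta> k. \<exists>w m. returns M I w m \<and> m \<le> N div (4 * k)" "1 \<le> k"
    for k and M :: "'n deterministic_method"
    by (rule fails[OF that(2) bspec[OF that(1)]])
  show "\<exists>I\<in>instances \<alpha> \<beta> k. \<exists>w m. returns M I w m \<and> real m \<ge> 1 / 85 * (\<beta> / (\<alpha> * real k))"
    if M: "\<forall>I\<in>instances \<alpha> \<beta> k. \<exists>w m. returns M I w m \<and> eps_optimal (\<alpha> / 8) I w" and k: "1 \<le> k"
    for k and M :: "'n deterministic_method"
  proof (rule ccontr)
    assume few: "\<not> ?thesis"
    have bound: "\<exists>w m. returns M I w m \<and> m \<le> N div (4 * k)" if I: "I \<in> instances \<alpha> \<beta> k" for I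
    proof -
      obtain w m where "returns M I w m" using M I by blast
      moreover from this have "real m < 1 / 85 * (\<kappa> / real k)"
        using few I assms(3) by (simp add: not_le)
      ultimately show ?thesis using oracle_budget_arithmetic[OF assms(4) k] by blast
    qed
    obtain I w_star w m where I: "I \<in> instances \<alpha> \<beta> k" "minimizer I w_star" "returns M I w m"
        "w \<notin> feasible I \<or> objective I w - objective I w_star \<ge> \<alpha> / 4"
      using fails[OF k bound] by blast
    \<comment> \<open>The guarantee speaks of some run; by determinism it is the failing one, and
      \<alpha>/4 exceeds \<alpha>/8.\<close>
    moreover obtain w' m' where "returns M I w' m'" "eps_optimal (\<alpha> / 8) I w'"
      using M I(1) by blast
    then have "eps_optimal (\<alpha> / 8) I w" using returns_from_unique[OF I(3)] by blast
    ultimately show False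
      using assms(1) by (simp add: eps_optimal_iff_minimizer[OF I(2)])
  qed
qed

end
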